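(* Let $\mathcal{A}$ be a commutative, associative, unital, finite-dimensional real algebra. Suppose $a_0,a_1,\dots,a_n$ are continuous functions on the connected set $I\subseteq\mathcal{A}$, where $a_0(z)\in\mathcal{A}^\times$ for each $z\in I$. Let $y_1,y_2,\dots,y_n$ be solutions of $a_0y^{(n)}+a_1y^{(n-1)}+\cdots+a_{n-1}y'+a_ny=0$. There exists $z_o\in I$ such that $W(y_1,y_2,\dots,y_n;z_o)\in\mathcal{A}^\times$ if and only if $\{y_1,y_2,\dots,y_n\}$ is linearly independent on $I$. Likewise, there exists $z_o\in I$ such that $W(y_1,y_2,\dots,y_n;z_o)\in\mathbf{zd}(\mathcal{A})$ if and only if $\{y_1,y_2,\dots,y_n\}$ is linearly dependent on $I$.
   Context: $\mathcal{A}^\times$ is the group of units of $\mathcal{A}$ and $\mathbf{zd}(\mathcal{A})=\{x\in\mathcal{A} : x=0 \text{ or } x \text{ is a zero-divisor}\}$. The coefficients and solutions are $\mathcal{A}$-valued, and derivatives are taken with respect to the $\mathcal{A}$-variable $z$: for an open set $U\subseteq\mathcal{A}$ containing $p$, a function $f:U\to\mathcal{A}$ is $\mathcal{A}$-differentiable at $p$ if there is a real-linear map $d_pf:\mathcal{A}\to\mathcal{A}$ with $d_pf(xy)=d_pf(x)y$ for all $x,y\in\mathcal{A}$ and $\lim_{h\to0}\frac{f(p+h)-f(p)-d_pf(h)}{\|h\|}=0$; then $f'(p)=d_pf(1)$, and $f^{(k)}=(f^{(k-1)})'$. The Wronskian $W(y_1,\dots,y_n;z)$ is the determinant over $\mathcal{A}$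 of the $n\times n$ matrix with $(i,j)$ entry $y_j^{(i-1)}(z)$. Functions $f_1,\dots,f_m:I\to\mathcal{A}$ are linearly independent on $I$ if, for $c_1,\dots,c_m\in\mathcal{A}$, $c_1f_1(z)+\cdots+c_mf_m(z)=0$ for all $z\in I$ implies $c_1=\cdots=c_m=0$; otherwise they are linearly dependent on $I$.
   Formalization: The connected set I is taken to be open (and nonempty), since derivatives are defined only on open sets and the claim fails for some connected sets that are not open; the algebra is taken to be nonzero and n at least 1. *)

theory Defs
  imports "HOL-Analysis.Analysis" "Jordan_Normal_Form.Determinant"
begin

text \<open>
  The algebra is a type \<open>'a\<close> of sort \<open>{real_algebra_1, comm_ring_1, euclidean_space}\<close>: a nonzero
  commutative unital real algebra of finite dimension. The Euclidean norm need not be related to the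
  multiplication; as all norms on a finite-dimensional space are equivalent, it only fixes the
  usual topology and does not affect which limits exist.
\<close>

text \<open>
  The library's \<open>has_derivative\<close> asks for a bounded linear map, which in finite dimension is the same
  as a real-linear map. Functions are total, but only their germ at \<open>p\<close> matters.
\<close>

definition has_alg_differential ::
  "('a::{real_algebra_1,comm_ring_1,euclidean_space} \<Rightarrow> 'a) \<Rightarrow> ('a \<Rightarrow> 'a) \<Rightarrow> 'a \<Rightarrow> bool"
  where "has_alg_differential f D p \<longleftrightarrow>
    (f has_derivative D) (at p) \<and> (\<forall>x y. D (x * y) = D x * y)"

definition alg_differentiable ::
  "('a::{real_algebra_1,comm_ring_1,euclidean_space} \<Rightarrow> 'a) \<Rightarrow> 'a \<Rightarrow> bool"
  where "alg_differentiable f p \<longleftrightarrow> (\<exists>D. has_alg_differential f D p)"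

definition alg_deriv ::
  "('a::{real_algebra_1,comm_ring_1,euclidean_space} \<Rightarrow> 'a) \<Rightarrow> 'a \<Rightarrow> 'a"
  where "alg_deriv f p = (THE D. has_alg_differential f D p) 1"

text \<open>
  Since \<open>alg_deriv\<close> has no meaning where a function is not differentiable, a solution of order \<open>n\<close>
  is explicitly required to have \<open>n\<close> derivatives on \<open>I\<close>. This is meant for open \<open>I\<close>.
\<close>

definition is_ode_solution ::
  "nat \<Rightarrow> (nat \<Rightarrow> 'a \<Rightarrow> 'a) \<Rightarrow> 'a set \<Rightarrow> ('a::{real_algebra_1,comm_ring_1,euclidean_space} \<Rightarrow> 'a) \<Rightarrow> bool"
  where "is_ode_solution n a I y \<longleftrightarrow>
    (\<forall>k<n. \<forall>z\<in>I. alg_differentiable ((alg_deriv ^^ k) y) z) \<and>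
    (\<forall>z\<in>I. (\<Sum>k\<le>n. a k z * (alg_deriv ^^ (n - k)) y z) = 0)"

text \<open>Matrix indices start at 0, the functions \<open>y 1, \<dots>, y n\<close> at 1.\<close>

definition wronskian ::
  "nat \<Rightarrow> (nat \<Rightarrow> 'a \<Rightarrow> 'a) \<Rightarrow> 'a::{real_algebra_1,comm_ring_1,euclidean_space} \<Rightarrow> 'a"
  where "wronskian n y z = Determinant.det (Matrix.mat n n (\<lambda>(i, j). (alg_deriv ^^ i) (y (Suc j)) z))"

definition alg_units :: "'a::comm_ring_1 set"
  where "alg_units = {x. x dvd 1}"

definition zd :: "'a::comm_ring_1 set"
  where "zd = {x. x = 0 \<or> (x \<noteq> 0 \<and> (\<exists>y. y \<noteq> 0 \<and> x * y = 0))}"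

text \<open>Independence of the family \<open>f 1, \<dots>, f m\<close> with coefficients in the algebra, not in the reals.\<close>

definition alg_lin_indep_on :: "nat \<Rightarrow> (nat \<Rightarrow> 'b \<Rightarrow> 'a::comm_ring_1) \<Rightarrow> 'b set \<Rightarrow> bool"
  where "alg_lin_indep_on m f I \<longleftrightarrow>
    (\<forall>c :: nat \<Rightarrow> 'a. (\<forall>z\<in>I. (\<Sum>j=1..m. c j * f j z) = 0) \<longrightarrow> (\<forall>j\<in>{1..m}. c j = 0))"

abbreviation alg_lin_dep_on :: "nat \<Rightarrow> (nat \<Rightarrow> 'b \<Rightarrow> 'a::comm_ring_1) \<Rightarrow> 'b set \<Rightarrow> bool"
  where "alg_lin_dep_on m f I \<equiv> \<not> alg_lin_indep_on m f I"

end

(*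
A null combination of the solutions can be differentiated, so its coefficients form a null vector of
the Wronski matrix at every point; multiplying by the adjugate, they vanish where the Wronskian is a
unit. In finite dimension a non-unit is a zero-divisor, so where the Wronskian is not a unit McCoy's
theorem gives a nonzero null vector of the Wronski matrix. The combination of the solutions with
these coefficients has zero initial data there, hence vanishes on the connected set by uniqueness.
*)

theory Submission
  imports Defs
begin

section \<open>Determinants and null vectors over a commutative ring\<close>

text \<open>Multiply the system by the adjugate: its product with the matrix is the determinant
  times the identity.\<close>

lemma det_mult_null_vector:
  fixes M :: "nat \<Rightarrow> nat \<Rightarrow> 'a::comm_ring_1"
  assumes c: "\<And>i. i < n \<Longrightarrow> (\<Sum>j<n. M i j * c j) = 0" and l: "l < n"
  shows "Determinant.det (Matrix.mat n n (\<lambda>(i, j). M i j)) * c l = 0"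
proof -
  define A where "A = Matrix.mat n n (\<lambda>(i, j). M i j)"
  have A: "A \<in> carrier_mat n n"
    by (simp add: A_def)
  have adj: "(\<Sum>i<n. adj_mat A $$ (l, i) * M i j) = (if l = j then Determinant.det A else 0)" if "j < n" for j
  proof -
    have "(\<Sum>i<n. adj_mat A $$ (l, i) * M i j) = (adj_mat A * A) $$ (l, j)"
      using adj_mat(1)[OF A] A that l by (simp add: scalar_prod_def lessThan_atLeast0 A_def)
    also have "\<dots> = (if l = j then Determinant.det A else 0)"
      unfolding adj_mat(3)[OF A] using that l by simp
    finally show ?thesis .
  qed
  have "Determinant.det A * c l = (\<Sum>j<n. if l = j then Determinant.det A * c j else 0)"
    using l by simp
  also have "\<dots> = (\<Sum>j<n. (\<Sum>i<n. adj_mat A $$ (l, i) * M i j) * c j)"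
    by (intro sum.cong) (auto simp: adj)
  also have "\<dots> = (\<Sum>i<n. \<Sum>j<n. adj_mat A $$ (l, i) * M i j * c j)"
    unfolding sum_distrib_right by (rule sum.swap)
  also have "\<dots> = (\<Sum>i<n. adj_mat A $$ (l, i) * (\<Sum>j<n. M i j * c j))"
    by (simp add: sum_distrib_left mult.assoc)
  also have "\<dots> = 0"
    by (simp add: c)
  finally show ?thesis
    by (simp add: A_def)
qed

text \<open>Border the given minor by one more column and a variable row. The cofactors along that
  row, times \<open>y\<close>, give the null vector: pairing them with row \<open>i\<close> of
  \<open>M\<close> expands a minor of order \<open>r + 1\<close>, which \<open>y\<close>
  annihilates.\<close>

lemma null_vector_of_maximal_minor:
  fixes M :: "nat \<Rightarrow> nat \<Rightarrow> 'a::comm_ring_1"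
  assumes r: "r < n"
    and f: "\<And>a. a < r \<Longrightarrow> f a < m" and g: "\<And>b. b < r \<Longrightarrow> g b < n"
    and ne: "y * Determinant.det (Matrix.mat r r (\<lambda>(a, b). M (f a) (g b))) \<noteq> 0"
    and kill: "\<And>f g. (\<And>a. a < Suc r \<Longrightarrow> f a < m) \<Longrightarrow> (\<And>b. b < Suc r \<Longrightarrow> g b < n) \<Longrightarrow>
      y * Determinant.det (Matrix.mat (Suc r) (Suc r) (\<lambda>(a, b). M (f a) (g b))) = 0"
  shows "\<exists>c. (\<exists>j<n. c j \<noteq> 0) \<and> (\<forall>i<m. (\<Sum>j<n. M i j * c j) = 0)"
proof -
  have "card (g ` {..<r}) < card {..<n}"
    using card_image_le[of "{..<r}" g] r by simp
  then have "\<not> {..<n} \<subseteq> g ` {..<r}"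
    by (meson card_mono finite_imageI finite_lessThan not_le)
  then obtain k where k: "k < n" "\<And>b. b < r \<Longrightarrow> g b \<noteq> k"
    by blast
  define h where "h b = (if b < r then g b else k)" for b
  have h: "h b < n" for b
    using g k by (simp add: h_def)
  define N where "N i = Matrix.mat (Suc r) (Suc r) (\<lambda>(a, b). M (if a < r then f a else i) (h b))" for i
  have N: "N i \<in> carrier_mat (Suc r) (Suc r)" for i
    by (simp add: N_def)
  define C where "C b = cofactor (N 0) r b" for b
  \<comment> \<open>Only the last row of \<open>N i\<close> depends on \<open>i\<close>, and these
    cofactors delete it.\<close>
  have C: "cofactor (N i) r b = C b" if "b < Suc r" for i b
  proof -
    have "mat_delete (N i) r b = mat_delete (N 0) r b"
      using that by (intro eq_matI) (auto simp: mat_delete_def N_def)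
    then show ?thesis
      by (simp add: C_def cofactor_def)
  qed
  have "mat_delete (N 0) r r = Matrix.mat r r (\<lambda>(a, b). M (f a) (g b))"
    by (intro eq_matI) (auto simp: mat_delete_def N_def h_def)
  then have Cr: "C r = Determinant.det (Matrix.mat r r (\<lambda>(a, b). M (f a) (g b)))"
    by (simp add: C_def cofactor_def)
  \<comment> \<open>As \<open>g\<close> may repeat a column, cofactors with the same column index
    are added up. Column \<open>k\<close> occurs once, so \<open>c k\<close> is \<open>y\<close>
    times the given minor.\<close>
  define c where "c l = y * (\<Sum>b<Suc r. if h b = l then C b else 0)" for l
  have "c k = y * C r"
    using k by (simp add: c_def h_def)
  then have "c k \<noteq> 0"
    using ne Cr by simp
  moreover have "(\<Sum>l<n. M i l * c l) = 0" if "i < m" for i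
  proof -
    have "(\<Sum>l<n. M i l * c l) = y * (\<Sum>l<n. \<Sum>b<Suc r. if h b = l then M i l * C b else 0)"
      unfolding c_def sum_distrib_left
      by (intro sum.cong refl) (simp add: algebra_simps)
    also have "\<dots> = y * (\<Sum>b<Suc r. \<Sum>l<n. if h b = l then M i l * C b else 0)"
      by (subst sum.swap) simp
    also have "\<dots> = y * (\<Sum>b<Suc r. M i (h b) * C b)"
      using h by simp
    also have "(\<Sum>b<Suc r. M i (h b) * C b) = Determinant.det (N i)"
      unfolding laplace_expansion_row[OF N lessI]
      by (intro sum.cong refl) (simp add: C, simp add: N_def)
    also have "y * \<dots> = 0"
      unfolding N_def by (rule kill) (use f h that in auto)
    finally show ?thesis .
  qed
  ultimately show ?thesis
    using k by blast
qed

text \<open>Selecting rows and columns, possibly with repetitions, is multiplication by 0-1 matrices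
  on both sides. Hence every minor of full order is a multiple of the determinant.\<close>

lemma mat_reindex:
  fixes M :: "nat \<Rightarrow> nat \<Rightarrow> 'a::comm_ring_1"
  assumes f: "\<And>a. a < n \<Longrightarrow> f a < n" and g: "\<And>b. b < n \<Longrightarrow> g b < n"
  shows "Matrix.mat n n (\<lambda>(a, b). M (f a) (g b)) =
    Matrix.mat n n (\<lambda>(a, i). if f a = i then 1 else 0) *
    (Matrix.mat n n (\<lambda>(i, j). M i j) * Matrix.mat n n (\<lambda>(j, b). if g b = j then 1 else 0))"
proof (intro eq_matI)
  let ?A = "Matrix.mat n n (\<lambda>(i, j). M i j)"
  let ?P = "Matrix.mat n n (\<lambda>(a, i). if f a = i then 1 else 0) :: 'a mat"
  let ?Q = "Matrix.mat n n (\<lambda>(j, b). if g b = j then 1 else 0) :: 'a mat"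
  fix a b
  assume "a < dim_row (?P * (?A * ?Q))" "b < dim_col (?P * (?A * ?Q))"
  then have a: "a < n" and b: "b < n"
    by auto
  have AQ: "(?A * ?Q) $$ (i, b) = M i (g b)" if "i < n" for i
  proof -
    have "(?A * ?Q) $$ (i, b) = (\<Sum>j<n. M i j * (if g b = j then 1 else 0))"
      using that b by (simp add: scalar_prod_def lessThan_atLeast0)
    also have "\<dots> = (\<Sum>j<n. if g b = j then M i j else 0)"
      by (intro sum.cong) auto
    finally show ?thesis
      using g[OF b] by simp
  qed
  have "(?P * (?A * ?Q)) $$ (a, b) = (\<Sum>i<n. (if f a = i then 1 else 0) * (?A * ?Q) $$ (i, b))"
    using a b by (simp add: scalar_prod_def lessThan_atLeast0)
  also have "\<dots> = (\<Sum>i<n. if f a = i then M i (g b) else 0)"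
    by (intro sum.cong) (auto simp: AQ)
  finally show "Matrix.mat n n (\<lambda>(a, b). M (f a) (g b)) $$ (a, b) = (?P * (?A * ?Q)) $$ (a, b)"
    using f[OF a] a b by simp
qed auto

text \<open>
  McCoy's theorem: take the largest order \<open>r\<close> such that \<open>y\<close> does not annihilate all minors of order
  \<open>r\<close>; the cofactors of a suitable minor of order \<open>r + 1\<close>, times \<open>y\<close>, form a null vector.
\<close>

lemma null_vector_of_zero_divisor_det:
  fixes M :: "nat \<Rightarrow> nat \<Rightarrow> 'a::comm_ring_1"
  assumes y: "y \<noteq> 0" and det: "Determinant.det (Matrix.mat n n (\<lambda>(i, j). M i j)) * y = 0"
  shows "\<exists>c. (\<exists>j<n. c j \<noteq> 0) \<and> (\<forall>i<n. (\<Sum>j<n. M i j * c j) = 0)"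
proof -
  \<comment> \<open>The index maps are arbitrary: repetitions only add vanishing minors, and
    permutations only change signs.\<close>
  define K where "K r \<longleftrightarrow> (\<forall>f g. (\<forall>a<r. f a < n) \<longrightarrow> (\<forall>b<r. g b < n) \<longrightarrow>
      y * Determinant.det (Matrix.mat r r (\<lambda>(a, b). M (f a) (g b))) = 0)" for r
  \<comment> \<open>The empty determinant is \<open>1\<close>, so the product is \<open>y\<close>
    itself.\<close>
  have "\<not> K 0"
    using y by (auto simp: K_def)
  moreover have "K n"
    unfolding K_def
  proof (intro allI impI)
    fix f g assume fg: "\<forall>a<n. f a < n" "\<forall>b<n. g b < n"
    let ?P = "Matrix.mat n n (\<lambda>(a, i). if f a = i then 1 else 0) :: 'a mat"
    let ?A = "Matrix.mat n n (\<lambda>(i, j). M i j)"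
    let ?Q = "Matrix.mat n n (\<lambda>(j, b). if g b = j then 1 else 0) :: 'a mat"
    have "Determinant.det (Matrix.mat n n (\<lambda>(a, b). M (f a) (g b))) = Determinant.det (?P * (?A * ?Q))"
      using mat_reindex[of n f g M] fg by simp
    also have "\<dots> = Determinant.det ?P * Determinant.det (?A * ?Q)"
      by (rule det_mult[of _ n]) auto
    also have "Determinant.det (?A * ?Q) = Determinant.det ?A * Determinant.det ?Q"
      by (rule det_mult[of _ n]) auto
    finally have "y * Determinant.det (Matrix.mat n n (\<lambda>(a, b). M (f a) (g b))) =
        Determinant.det ?P * (Determinant.det ?A * y) * Determinant.det ?Q"
      by (simp only: ac_simps)
    then show "y * Determinant.det (Matrix.mat n n (\<lambda>(a, b). M (f a) (g b))) = 0"
      unfolding det by simp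
  qed
  ultimately obtain r where r: "r < n" "\<not> K r" "K (Suc r)"
    using ex_least_nat_less[of K n] by blast
  from r(2) obtain f g where "\<forall>a<r. f a < n" "\<forall>b<r. g b < n"
    "y * Determinant.det (Matrix.mat r r (\<lambda>(a, b). M (f a) (g b))) \<noteq> 0"
    by (auto simp: K_def)
  then show ?thesis
    using r(1,3) by (intro null_vector_of_maximal_minor[of r n f n g y]) (auto simp: K_def)
qed

section \<open>Units and zero-divisors\<close>

lemma zdE:
  assumes "x \<in> zd"
  obtains y where "y \<noteq> 0" "x * y = 0"
  using assms by (cases "x = 0") (auto simp: zd_def intro: that[of 1])

text \<open>Multiplication by \<open>x\<close> is a linear endomorphism of a finite-dimensional real
  space, so it is injective iff it is surjective. For a non-unit it misses \<open>1\<close>, and any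
  nonzero kernel element is a witness.\<close>

lemma zd_iff_not_unit:
  fixes x :: "'a::{real_algebra_1,comm_ring_1,euclidean_space}"
  shows "x \<in> zd \<longleftrightarrow> x \<notin> alg_units"
proof
  assume "x \<in> zd"
  then obtain y where y: "y \<noteq> 0" "x * y = 0"
    by (rule zdE)
  show "x \<notin> alg_units"
  proof
    assume "x \<in> alg_units"
    then obtain u where u: "1 = x * u"
      by (auto simp: alg_units_def)
    have "y = y * (x * u)"
      by (simp flip: u)
    also have "\<dots> = (x * y) * u"
      by (simp only: ac_simps)
    finally show False
      using y by simp
  qed
next
  assume x: "x \<notin> alg_units"
  have lin: "linear ((*) x)"
    by (rule linearI) (auto simp: algebra_simps)
  have "\<not> surj ((*) x)"
  proof
    assume "surj ((*) x)"
    then obtain u where "1 = x * u"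
      by (rule surjE)
    then have "x dvd 1"
      by (rule dvdI)
    with x show False
      by (simp add: alg_units_def)
  qed
  then have "\<not> inj ((*) x)"
    using linear_injective_imp_surjective[OF lin] by blast
  then obtain y where "y \<noteq> 0" "x * y = 0"
    using linear_injective_0[OF lin] by blast
  then show "x \<in> zd"
    by (auto simp: zd_def)
qed

section \<open>Norm estimates and the derivative over the algebra\<close>

lemma bounded_bilinear_alg_mult:
  "bounded_bilinear (\<lambda>x y :: 'a::{real_algebra_1,comm_ring_1,euclidean_space}. x * y)"
  unfolding bilinear_conv_bounded_bilinear[symmetric] bilinear_def
  by (auto intro!: linearI simp: algebra_simps)

text \<open>The Euclidean norm need not be submultiplicative; the constant \<open>K\<close> makes up
  for this in all estimates.\<close>

lemma alg_mult_bound: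
  obtains K :: real where "K > 0"
    and "\<And>x y :: 'a::{real_algebra_1,comm_ring_1,euclidean_space}. norm (x * y) \<le> K * norm x * norm y"
  using bounded_bilinear.pos_bounded[OF bounded_bilinear_alg_mult] by (metis mult.assoc mult.commute)

text \<open>The differential is unique and linear over the algebra, so its value at
  \<open>h = 1 * h\<close> is its value at \<open>1\<close> times \<open>h\<close>.\<close>

lemma alg_differentiable_imp_has_derivative:
  assumes "alg_differentiable f p"
  shows "(f has_derivative (\<lambda>h. alg_deriv f p * h)) (at p)"
proof -
  obtain D where D: "has_alg_differential f D p"
    using assms by (auto simp: alg_differentiable_def)
  then have "(THE D. has_alg_differential f D p) = D"
    by (intro the_equality) (auto simp: has_alg_differential_def intro: has_derivative_unique)
  then have "D h = alg_deriv f p * h" for h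
    using D by (metis alg_deriv_def has_alg_differential_def mult.left_neutral)
  then have "D = (\<lambda>h. alg_deriv f p * h)"
    by blast
  then show ?thesis
    using D by (simp add: has_alg_differential_def)
qed


section \<open>Uniqueness for the initial value problem\<close>

text \<open>\<open>F i\<close> stands for the \<open>i\<close>-th derivative of a solution
  \<open>F 0\<close>. Taking the whole jet as data lets linear combinations of solutions be treated
  without computing their iterated \<open>alg_deriv\<close>.\<close>

locale alg_ode_system =
  fixes I :: "'a::{real_algebra_1,comm_ring_1,euclidean_space} set"
    and n :: nat and a F :: "nat \<Rightarrow> 'a \<Rightarrow> 'a"
  assumes open_I: "open I"
    and cont: "\<And>k. k \<le> n \<Longrightarrow> continuous_on I (a k)"
    and unit: "\<And>z. z \<in> I \<Longrightarrow> a 0 z \<in> alg_units"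
    and deriv: "\<And>i z. i < n \<Longrightarrow> z \<in> I \<Longrightarrow> (F i has_derivative (\<lambda>h. F (Suc i) z * h)) (at z)"
    and ode: "\<And>z. z \<in> I \<Longrightarrow> (\<Sum>k\<le>n. a k z * F (n - k) z) = 0"
begin

text \<open>
  Solving for the top derivative needs no continuity of the inverse: multiplication by the
  inverse \<open>u\<close> of \<open>a 0 z\<^sub>0\<close> makes the leading coefficient close to \<open>1\<close> near \<open>z\<^sub>0\<close>.
\<close>

lemma top_derivative_bound:
  assumes z0: "z\<^sub>0 \<in> I"
  obtains e C where "e > 0" "cball z\<^sub>0 e \<subseteq> I"
    "\<And>z. z \<in> cball z\<^sub>0 e \<Longrightarrow> norm (F n z) \<le> C * (\<Sum>i<n. norm (F i z))"
proof -
  obtain K :: real where K: "K > 0" "\<And>x y :: 'a. norm (x * y) \<le> K * norm x * norm y"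
    using alg_mult_bound by blast
  obtain u where u: "a 0 z\<^sub>0 * u = 1"
    using unit[OF z0] by (auto simp: alg_units_def dvd_def)
  have cu: "continuous_on I (\<lambda>z. u * a k z)" if "k \<le> n" for k
    using that by (intro bounded_bilinear.continuous_on[OF bounded_bilinear_alg_mult] cont continuous_on_const)
  have "isCont (\<lambda>z. 1 - u * a 0 z) z\<^sub>0"
    using cu[of 0] z0 open_I by (intro continuous_intros) (simp add: continuous_on_eq_continuous_at)
  then have "isCont (\<lambda>z. norm (1 - u * a 0 z)) z\<^sub>0"
    by (rule continuous_norm)
  moreover have "norm (1 - u * a 0 z\<^sub>0) = 0"
    using u by (simp add: mult.commute)
  \<comment> \<open>With this threshold, \<open>(1 - u * a 0 z) * F n z\<close> has at most half the
    norm of \<open>F n z\<close> and can be absorbed; this gives the factor 2 in the final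
    bound.\<close>
  moreover have "1 / (2 * K) > 0"
    using K(1) by simp
  ultimately obtain d1 where d1: "d1 > 0" "\<And>z. dist z z\<^sub>0 < d1 \<Longrightarrow> norm (1 - u * a 0 z) < 1 / (2 * K)"
    unfolding continuous_at_eps_delta by (metis abs_norm_cancel diff_zero dist_real_def)
  obtain d2 where d2: "d2 > 0" "ball z\<^sub>0 d2 \<subseteq> I"
    using open_I z0 by (rule openE)
  define d where "d = min d1 d2"
  have d: "d > 0" "\<And>z. dist z z\<^sub>0 < d \<Longrightarrow> norm (1 - u * a 0 z) < 1 / (2 * K)"
    "\<And>z. dist z z\<^sub>0 < d \<Longrightarrow> z \<in> I"
    using d1 d2 by (auto simp: d_def dist_commute subset_iff)
  \<comment> \<open>Halving the radius leaves a compact ball inside \<open>I\<close>, on which the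
    other coefficients are bounded.\<close>
  define e where "e = d / 2"
  have e: "e > 0" "cball z\<^sub>0 e \<subseteq> I"
    and small: "\<And>z. z \<in> cball z\<^sub>0 e \<Longrightarrow> norm (1 - u * a 0 z) < 1 / (2 * K)"
    using d by (auto simp: e_def dist_commute subset_iff)
  have "\<exists>B. \<forall>z\<in>cball z\<^sub>0 e. norm (u * a k z) \<le> B" if "k \<in> {1..n}" for k
  proof -
    have "continuous_on (cball z\<^sub>0 e) (\<lambda>z. u * a k z)"
      using that by (intro continuous_on_subset[OF cu e(2)]) auto
    then have "bounded ((\<lambda>z. u * a k z) ` cball z\<^sub>0 e)"
      by (intro compact_imp_bounded compact_continuous_image compact_cball)
    then show ?thesis
      by (auto simp: bounded_iff)
  qed
  then obtain B where B: "\<And>k z. k \<in> {1..n} \<Longrightarrow> z \<in> cball z\<^sub>0 e \<Longrightarrow> norm (u * a k z) \<le> B k"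
    by metis
  define B' where "B' = (\<Sum>k=1..n. \<bar>B k\<bar>)"
  have B': "norm (u * a k z) \<le> B'" if "k \<in> {1..n}" "z \<in> cball z\<^sub>0 e" for k z
  proof -
    have "\<bar>B k\<bar> \<le> B'"
      unfolding B'_def using that(1) by (intro member_le_sum) auto
    then show ?thesis
      using B[OF that] by linarith
  qed
  show ?thesis
  proof (rule that[OF e, of "2 * (K * B')"])
    fix z assume z: "z \<in> cball z\<^sub>0 e"
    then have zI: "z \<in> I"
      using e by blast
    have "0 = a 0 z * F n z + (\<Sum>k=1..n. a k z * F (n - k) z)"
      using ode[OF zI] by (simp add: atMost_atLeast0 sum.atLeast_Suc_atMost)
    then have "u * 0 = u * (a 0 z * F n z + (\<Sum>k=1..n. a k z * F (n - k) z))"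
      by (rule arg_cong)
    then have "0 = u * a 0 z * F n z + (\<Sum>k=1..n. u * a k z * F (n - k) z)"
      by (simp add: distrib_left sum_distrib_left mult.assoc)
    then have "F n z = (1 - u * a 0 z) * F n z - (\<Sum>k=1..n. u * a k z * F (n - k) z)"
      by (simp add: algebra_simps)
    then have "norm (F n z) \<le> norm ((1 - u * a 0 z) * F n z) + norm (\<Sum>k=1..n. u * a k z * F (n - k) z)"
      by (metis norm_triangle_ineq4)
    also have "norm ((1 - u * a 0 z) * F n z) \<le> K * (1 / (2 * K)) * norm (F n z)"
      using K small[OF z] by (intro order_trans[OF K(2)] mult_right_mono mult_left_mono) auto
    also have "K * (1 / (2 * K)) = 1 / 2"
      using K(1) by simp
    also have "norm (\<Sum>k=1..n. u * a k z * F (n - k) z) \<le> (\<Sum>k=1..n. K * B' * norm (F (n - k) z))"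
    proof (rule sum_norm_le)
      fix k assume "k \<in> {1..n}"
      then have "K * norm (u * a k z) * norm (F (n - k) z) \<le> K * B' * norm (F (n - k) z)"
        using B' z K(1) by (intro mult_right_mono mult_left_mono) auto
      with K(2)[of "u * a k z" "F (n - k) z"]
      show "norm (u * a k z * F (n - k) z) \<le> K * B' * norm (F (n - k) z)"
        by linarith
    qed
    also have "\<dots> = K * B' * (\<Sum>k=1..n. norm (F (n - k) z))"
      by (simp add: sum_distrib_left)
    also have "(\<Sum>k=1..n. norm (F (n - k) z)) = (\<Sum>i<n. norm (F i z))"
      by (rule sum.reindex_bij_witness[of _ "\<lambda>i. n - i" "\<lambda>k. n - k"]) auto
    finally show "norm (F n z) \<le> 2 * (K * B') * (\<Sum>i<n. norm (F i z))"
      by simp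
  qed
qed

lemma continuous_on_jet: "i < n \<Longrightarrow> continuous_on I (F i)"
  using deriv by (intro continuous_at_imp_continuous_on) (auto intro: has_derivative_continuous)

text \<open>
  On a small ball of radius \<open>r\<close> the mean value inequality bounds the maximum \<open>S\<close> of the size of
  the jet by \<open>S / 2\<close>.
\<close>

lemma jet_zero_locally:
  assumes z0: "z\<^sub>0 \<in> I" and zero: "\<And>i. i < n \<Longrightarrow> F i z\<^sub>0 = 0"
  obtains r where "r > 0" "ball z\<^sub>0 r \<subseteq> I" "\<And>i z. i < n \<Longrightarrow> z \<in> ball z\<^sub>0 r \<Longrightarrow> F i z = 0"
proof -
  obtain K :: real where K: "K > 0" "\<And>x y :: 'a. norm (x * y) \<le> K * norm x * norm y"
    using alg_mult_bound by blast
  obtain e C where e: "e > 0" "cball z\<^sub>0 e \<subseteq> I"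
    and C: "\<And>z. z \<in> cball z\<^sub>0 e \<Longrightarrow> norm (F n z) \<le> C * (\<Sum>i<n. norm (F i z))"
    using top_derivative_bound[OF z0] by blast
  define g where "g z = (\<Sum>i<n. norm (F i z))" for z
  have g0: "g z \<ge> 0" for z
    by (simp add: g_def sum_nonneg)
  \<comment> \<open>\<open>C\<close> handles the top derivative; 1 suffices for the lower ones,
    whose norms are summands of \<open>g\<close>.\<close>
  define D where "D = max 1 C"
  have D: "norm (F (Suc i) z) \<le> D * g z" if "i < n" "z \<in> cball z\<^sub>0 e" for i z
  proof (cases "Suc i = n")
    case True
    have "norm (F n z) \<le> C * g z"
      using C[OF that(2)] by (simp add: g_def)
    also have "\<dots> \<le> D * g z"
      using g0 by (intro mult_right_mono) (auto simp: D_def)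
    finally show ?thesis
      using True by simp
  next
    case False
    then have "norm (F (Suc i) z) \<le> g z"
      using that unfolding g_def by (intro member_le_sum) auto
    also have "\<dots> \<le> D * g z"
      using g0 mult_right_mono[of 1 D "g z"] by (simp add: D_def)
    finally show ?thesis .
  qed
  have D1: "D \<ge> 1"
    by (simp add: D_def)
  \<comment> \<open>Chosen to make \<open>real n * (K * D * r)\<close> at most 1/2;
    \<open>real n + 1\<close> keeps the denominator positive for \<open>n = 0\<close>.\<close>
  define r where "r = min e (1 / (2 * (real n + 1) * K * D))"
  have r: "0 < r" "r \<le> e"
    using e K D1 by (auto simp: r_def)
  have "r * (2 * (real n + 1) * K * D) \<le> 1 / (2 * (real n + 1) * K * D) * (2 * (real n + 1) * K * D)"
    using K D1 by (intro mult_right_mono) (auto simp: r_def)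
  then have r2: "real n * (K * D * r) \<le> 1 / 2"
    using K D1 r by (simp add: algebra_simps) (smt (verit) mult_pos_pos)
  have sub: "cball z\<^sub>0 r \<subseteq> cball z\<^sub>0 e" "cball z\<^sub>0 r \<subseteq> I"
    using r e by auto
  have "continuous_on (cball z\<^sub>0 r) g"
    unfolding g_def
    by (intro continuous_intros continuous_on_subset[OF continuous_on_jet sub(2)]) auto
  then obtain m where m: "m \<in> cball z\<^sub>0 r" "\<And>z. z \<in> cball z\<^sub>0 r \<Longrightarrow> g z \<le> g m"
    using continuous_attains_sup[of "cball z\<^sub>0 r" g] r by auto
  have *: "norm (F i m) \<le> K * D * r * g m" if i: "i < n" for i
  proof -
    have "norm (F i m - F i z\<^sub>0) \<le> (K * (D * g m)) * norm (m - z\<^sub>0)"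
    proof (rule differentiable_bound[of "cball z\<^sub>0 r" "F i" "\<lambda>z h. F (Suc i) z * h"])
      show "(F i has_derivative (\<lambda>h. F (Suc i) z * h)) (at z within cball z\<^sub>0 r)"
        if "z \<in> cball z\<^sub>0 r" for z
        using deriv[OF i] that sub by (blast intro: has_derivative_at_withinI)
      show "onorm (\<lambda>h. F (Suc i) z * h) \<le> K * (D * g m)" if z: "z \<in> cball z\<^sub>0 r" for z
      proof (rule onorm_le)
        fix h :: 'a
        have "D * g z \<le> D * g m"
          using m(2)[OF z] D1 by (intro mult_left_mono) auto
        then have "norm (F (Suc i) z) \<le> D * g m"
          using D[OF i] z sub by fastforce
        then have "K * norm (F (Suc i) z) * norm h \<le> K * (D * g m) * norm h"
          using K by (intro mult_right_mono mult_left_mono) auto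
        with K(2)[of "F (Suc i) z" h] show "norm (F (Suc i) z * h) \<le> K * (D * g m) * norm h"
          by linarith
      qed
    qed (use m r in auto)
    also have "\<dots> \<le> (K * (D * g m)) * r"
      using m(1) K D1 g0 by (intro mult_left_mono) (auto simp: dist_norm norm_minus_commute)
    finally show ?thesis
      using zero[OF i] by (simp add: mult_ac)
  qed
  have "g m \<le> (\<Sum>i<n. K * D * r * g m)"
    unfolding g_def[of m] by (intro sum_mono) (use * in \<open>auto simp flip: g_def\<close>)
  also have "\<dots> = real n * (K * D * r) * g m"
    by simp
  also have "\<dots> \<le> 1 / 2 * g m"
    using r2 g0 by (rule mult_right_mono)
  finally have "g m \<le> 0"
    by simp
  have "F i z = 0" if "i < n" "z \<in> ball z\<^sub>0 r" for i z
  proof -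
    have "norm (F i z) \<le> g z"
      using that unfolding g_def by (intro member_le_sum) auto
    also have "\<dots> \<le> 0"
      using m(2)[of z] that \<open>g m \<le> 0\<close> by auto
    finally show ?thesis
      by simp
  qed
  then show ?thesis
    using that[of r] r(1) sub(2) ball_subset_cball by blast
qed

text \<open>The points of \<open>I\<close> where the jet vanishes form a set that is open in
  \<open>I\<close> by local uniqueness, closed in \<open>I\<close> by continuity, and contains
  \<open>z\<^sub>0\<close>.\<close>

lemma jet_zero:
  assumes "connected I" and z0: "z\<^sub>0 \<in> I" and zero: "\<And>i. i < n \<Longrightarrow> F i z\<^sub>0 = 0"
    and z: "z \<in> I" and i: "i < n"
  shows "F i z = 0"
proof -
  define T where "T = {z \<in> I. \<forall>i<n. F i z = 0}"
  have "openin (top_of_set I) T"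
  proof (subst openin_open_eq[OF open_I], intro conjI)
    show "open T"
      unfolding open_contains_ball
    proof
      fix w assume "w \<in> T"
      then obtain r where "r > 0" "ball w r \<subseteq> I" "\<And>i z. i < n \<Longrightarrow> z \<in> ball w r \<Longrightarrow> F i z = 0"
        using jet_zero_locally[of w] unfolding T_def by blast
      then show "\<exists>r>0. ball w r \<subseteq> T"
        unfolding T_def by blast
    qed
  qed (auto simp: T_def)
  moreover have "closedin (top_of_set I) T"
  proof -
    \<comment> \<open>The index set is nonempty since \<open>i < n\<close>; an empty intersection
      would be the whole type.\<close>
    have "T = (\<Inter>i\<in>{..<n}. {z \<in> I. F i z = 0})"
      using i by (auto simp: T_def)
    moreover have "closedin (top_of_set I) (\<Inter>i\<in>{..<n}. {z \<in> I. F i z = 0})"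
      using i continuous_closedin_preimage_constant[OF continuous_on_jet]
      by (intro closedin_INT) auto
    ultimately show ?thesis
      by simp
  qed
  moreover have "z\<^sub>0 \<in> T"
    using z0 zero by (simp add: T_def)
  ultimately have "T = I"
    using \<open>connected I\<close> unfolding connected_clopen by blast
  then show ?thesis
    using z i by (auto simp: T_def)
qed

end

section \<open>Null combinations of solutions and the Wronskian\<close>

text \<open>A function that is zero on an open set has zero differential there; at
  \<open>h = 1\<close> this gives the next entry of the jet.\<close>

lemma jet_zero_of_zero:
  fixes F :: "nat \<Rightarrow> 'a::{real_algebra_1,comm_ring_1,euclidean_space} \<Rightarrow> 'a"
  assumes "open I"
    and deriv: "\<And>i z. i < n \<Longrightarrow> z \<in> I \<Longrightarrow> (F i has_derivative (\<lambda>h. F (Suc i) z * h)) (at z)"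
    and zero: "\<And>z. z \<in> I \<Longrightarrow> F 0 z = 0"
  shows "i \<le> n \<Longrightarrow> z \<in> I \<Longrightarrow> F i z = 0"
proof (induction i arbitrary: z)
  case 0
  then show ?case
    using zero by simp
next
  case (Suc i)
  have "(F i has_derivative (\<lambda>h. 0)) (at z)"
    by (rule has_derivative_transform_within_open[OF has_derivative_const[of 0] \<open>open I\<close> Suc.prems(2)])
      (use Suc in auto)
  moreover have "(F i has_derivative (\<lambda>h. F (Suc i) z * h)) (at z)"
    using deriv Suc.prems by simp
  ultimately have "(\<lambda>h. F (Suc i) z * h) = (\<lambda>h. 0)"
    by (blast intro: has_derivative_unique)
  then show ?case
    by (metis mult.right_neutral)
qed

theorem corollary3p8:
  fixes I :: "'a::{real_algebra_1,comm_ring_1,euclidean_space} set"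
    and a y :: "nat \<Rightarrow> 'a \<Rightarrow> 'a"
    and n :: nat
  assumes "n \<ge> 1"
    and "open I" and "connected I" and "I \<noteq> {}"
    and "\<And>k. k \<le> n \<Longrightarrow> continuous_on I (a k)"
    and "\<And>z. z \<in> I \<Longrightarrow> a 0 z \<in> alg_units"
    and "\<And>j. j \<in> {1..n} \<Longrightarrow> is_ode_solution n a I (y j)"
  shows "((\<exists>z\<^sub>0\<in>I. wronskian n y z\<^sub>0 \<in> alg_units) \<longleftrightarrow> alg_lin_indep_on n y I) \<and>
         ((\<exists>z\<^sub>0\<in>I. wronskian n y z\<^sub>0 \<in> zd) \<longleftrightarrow> alg_lin_dep_on n y I)"
proof -
  \<comment> \<open>This has two readings: the \<open>i\<close>-th derivative of the combination
    with coefficients \<open>c\<close>, and row \<open>i\<close> of the Wronski matrix applied to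
    \<open>c\<close>. Here \<open>c\<close> is indexed from 0, one below the index of
    \<open>y\<close>.\<close>
  define F where "F c i z = (\<Sum>j<n. (alg_deriv ^^ i) (y (Suc j)) z * c j)" for c :: "nat \<Rightarrow> 'a" and i z
  have deriv: "(F c i has_derivative (\<lambda>h. F c (Suc i) z * h)) (at z)" if "i < n" "z \<in> I" for c i z
  proof -
    have "((alg_deriv ^^ i) (y (Suc j)) has_derivative (\<lambda>h. (alg_deriv ^^ Suc i) (y (Suc j)) z * h)) (at z)"
      if "j < n" for j
      using alg_differentiable_imp_has_derivative[of "(alg_deriv ^^ i) (y (Suc j))" z]
        assms(7)[of "Suc j"] \<open>i < n\<close> \<open>z \<in> I\<close> that by (auto simp: is_ode_solution_def)
    moreover have "bounded_linear (\<lambda>x. x * c j)" for j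
      by (rule bounded_bilinear.bounded_linear_left[OF bounded_bilinear_alg_mult])
    ultimately have "((\<lambda>z. \<Sum>j<n. (alg_deriv ^^ i) (y (Suc j)) z * c j) has_derivative
        (\<lambda>h. \<Sum>j<n. (alg_deriv ^^ Suc i) (y (Suc j)) z * h * c j)) (at z)"
      by (intro has_derivative_sum) (rule bounded_linear.has_derivative, auto)
    then show ?thesis
      unfolding F_def[abs_def] sum_distrib_right by (simp add: mult_ac)
  qed
  have ode: "(\<Sum>k\<le>n. a k z * F c (n - k) z) = 0" if "z \<in> I" for c z
  proof -
    have "(\<Sum>k\<le>n. a k z * F c (n - k) z) =
        (\<Sum>j<n. (\<Sum>k\<le>n. a k z * (alg_deriv ^^ (n - k)) (y (Suc j)) z) * c j)"
      unfolding F_def sum_distrib_left sum_distrib_right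
      by (subst sum.swap) (simp only: mult.assoc)
    also have "\<dots> = 0"
      using assms(7) that by (intro sum.neutral) (auto simp: is_ode_solution_def)
    finally show ?thesis .
  qed
  have sys: "alg_ode_system I n a (F c)" for c
    using assms deriv ode by unfold_locales auto
  have F0: "F c 0 z = (\<Sum>j=1..n. c (j - 1) * y j z)" for c z
    by (simp add: F_def sum.atLeast1_atMost_eq mult.commute)
  have W: "wronskian n y z = Determinant.det (Matrix.mat n n (\<lambda>(i, j). (alg_deriv ^^ i) (y (Suc j)) z))" for z
    by (simp add: wronskian_def)
  have dep: "alg_lin_dep_on n y I" if z: "z \<in> I" and zd: "wronskian n y z \<in> zd" for z
  proof -
    obtain d where "d \<noteq> 0" "wronskian n y z * d = 0"
      using zd by (rule zdE)
    then obtain c where c: "\<exists>j<n. c j \<noteq> 0" "\<forall>i<n. F c i z = 0"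
      unfolding W F_def
      using null_vector_of_zero_divisor_det[of d n "\<lambda>i j. (alg_deriv ^^ i) (y (Suc j)) z"] by blast
    interpret alg_ode_system I n a "F c"
      by (rule sys)
    \<comment> \<open>The null vector \<open>c\<close> says that the jet of the combination vanishes
      at \<open>z\<close>. Order 0 belongs to this jet because \<open>n\<close> is at least
      1.\<close>
    have "F c 0 w = 0" if "w \<in> I" for w
      using jet_zero[OF assms(3) z _ that] c(2) assms(1) by auto
    then have *: "\<forall>w\<in>I. (\<Sum>j=1..n. c (j - 1) * y j w) = 0"
      by (simp add: F0)
    show ?thesis
    proof
      assume "alg_lin_indep_on n y I"
      then have 0: "\<forall>j\<in>{1..n}. c (j - 1) = 0"
        unfolding alg_lin_indep_on_def by (rule allE[of _ "\<lambda>j. c (j - 1)"]) (use * in simp)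
      have "c j = 0" if "j < n" for j
        using bspec[OF 0, of "Suc j"] that by simp
      with c(1) show False
        by blast
    qed
  qed
  have indep: "alg_lin_indep_on n y I" if z: "z \<in> I" and unit: "wronskian n y z \<in> alg_units" for z
    unfolding alg_lin_indep_on_def
  proof (intro allI impI ballI)
    fix c :: "nat \<Rightarrow> 'a" and j
    assume c: "\<forall>z\<in>I. (\<Sum>j=1..n. c j * y j z) = 0" and j: "j \<in> {1..n}"
    define c' where "c' j = c (Suc j)" for j
    have "F c' 0 w = 0" if "w \<in> I" for w
      using c that by (auto simp: F0 c'_def)
    then have "F c' i z = 0" if "i < n" for i
      using jet_zero_of_zero[of I n "F c'" i z, OF assms(2) deriv] z that by simp
    then have "wronskian n y z * c' (j - 1) = 0"
      unfolding W using j by (intro det_mult_null_vector) (auto simp: F_def)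
    moreover have "wronskian n y z \<notin> zd"
      using unit by (simp add: zd_iff_not_unit)
    ultimately have "c' (j - 1) = 0"
      by (auto simp: zd_def)
    then show "c j = 0"
      using j by (simp add: c'_def)
  qed
  \<comment> \<open>At each point the Wronskian is either a unit or in \<open>zd\<close>, so
    \<open>dep\<close> and \<open>indep\<close> yield each other's converse; \<open>z\<close>
    provides a point for the existence claims.\<close>
  obtain z where "z \<in> I"
    using assms(4) by blast
  then show ?thesis
    using dep indep zd_iff_not_unit by blast
qed

end
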